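(* Let $p=\frac{2\ell}{2\ell-1}$ for some $\ell\in\mathbb{N}$. Then there exists a real number $C_p>1$ such that for every $\varepsilon\in(0,1)$ we have $$N_p^{\overline{\mathrm{disc}}}(\varepsilon,d)\ \ge\ C_p^d\,(1+o(1))\qquad\text{as } d\to\infty,$$ i.e. there is a sequence $(r_d)_{d\ge1}$ (possibly depending on $\varepsilon$) with $r_d\to0$ and $N_p^{\overline{\mathrm{disc}}}(\varepsilon,d)\ge C_p^d(1+r_d)$ for all $d$. In particular, the generalized $L_p$-discrepancy suffers from the curse of dimensionality for all such $p$.
   Context: For points $\mathcal{P}=\{\boldsymbol{x}_1,\dots,\boldsymbol{x}_N\}\subset[0,1)^d$ and real coefficients $\mathcal{A}=\{a_1,\dots,a_N\}$, the generalized discrepancy function is $\overline{\Delta}_{\mathcal{P},\mathcal{A}}(\boldsymbol{t})=\sum_{k=1}^N a_k\mathbf{1}_{[\boldsymbol{0},\boldsymbol{t})}(\boldsymbol{x}_k)-t_1t_2\cdots t_d$ for $\boldsymbol{t}\in[0,1]^d$, where $[\boldsymbol{0},\boldsymbol{t})=[0,t_1)\times\cdots\times[0,t_d)$, and for $p\in[1,\infty)$ the generalized $L_p$-discrepancy is $\overline{L}_{p,N}(\mathcal{P},\mathcal{A})=\left(\int_{[0,1]^d}|\overline{\Delta}_{\mathcal{P},\mathcal{A}}(\boldsymbol{t})|^p\,d\boldsymbol{t}\right)^{1/p}$. Let $\overline{\mathrm{disc}}_p(N,d)=\min_{\mathcal{P},\mathcal{A}}\overline{L}_{p,N}(\mathcal{P},\mathcal{A})$,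 the minimum over all $N$-element point sets in $[0,1)^d$ and all coefficient choices, and $\overline{\mathrm{disc}}_p(0,d)=(p+1)^{-d/p}$ (the $L_p$-norm of $\boldsymbol{t}\mapsto t_1\cdots t_d$). The inverse is $N_p^{\overline{\mathrm{disc}}}(\varepsilon,d)=\min\{N\in\mathbb{N}:\overline{\mathrm{disc}}_p(N,d)\le\varepsilon\,\overline{\mathrm{disc}}_p(0,d)\}$. *)

theory Defs
  imports "HOL-Analysis.Analysis"
begin

definition gen_disc_fun :: "nat \<Rightarrow> nat \<Rightarrow> (nat \<Rightarrow> nat \<Rightarrow> real) \<Rightarrow> (nat \<Rightarrow> real) \<Rightarrow> (nat \<Rightarrow> real) \<Rightarrow> real" where
  "gen_disc_fun d N x a t =
     (\<Sum>k<N. a k * (if (\<forall>i<d. 0 \<le> x k i \<and> x k i < t i) then 1 else 0)) - (\<Prod>i<d. t i)"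

definition unit_cube :: "nat \<Rightarrow> (nat \<Rightarrow> real) measure" where
  "unit_cube d = PiM {..<d} (\<lambda>_. restrict_space lborel {0..1})"

definition gen_Lp_disc :: "real \<Rightarrow> nat \<Rightarrow> nat \<Rightarrow> (nat \<Rightarrow> nat \<Rightarrow> real) \<Rightarrow> (nat \<Rightarrow> real) \<Rightarrow> real" where
  "gen_Lp_disc p d N x a =
     (\<integral>t. \<bar>gen_disc_fun d N x a t\<bar> powr p \<partial>unit_cube d) powr (1 / p)"

definition point_sets :: "nat \<Rightarrow> nat \<Rightarrow> (nat \<Rightarrow> nat \<Rightarrow> real) set" where
  "point_sets d N = {x. \<forall>k<N. \<forall>i<d. 0 \<le> x k i \<and> x k i < 1}"

definition gen_disc :: "real \<Rightarrow> nat \<Rightarrow> nat \<Rightarrow> real" where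
  "gen_disc p N d =
     (if N = 0 then (p + 1) powr (- real d / p)
      else Inf {gen_Lp_disc p d N x a | x a. x \<in> point_sets d N})"

definition inv_gen_disc :: "real \<Rightarrow> real \<Rightarrow> nat \<Rightarrow> nat" where
  "inv_gen_disc p \<epsilon> d = (LEAST N. gen_disc p N d \<le> \<epsilon> * gen_disc p 0 d)"

end

theory Submission
  imports Defs "HOL-Probability.Infinite_Product_Measure"
begin

text \<open>
  Let \<open>q = 2l\<close> be the exponent conjugate to \<open>p\<close> and \<open>s = p - 1 = 1 / (2l - 1)\<close>. Testing the
  discrepancy function against \<open>F\<close> in \<open>L\<^sub>q\<close> bounds its \<open>L\<^sub>p\<close>-norm from below, and
  \<open>F(t) = \<Prod>i. t\<^sub>i powr s\<close> is extremal when there are no points. We split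
  \<open>t powr s = g\<^sub>0 + g\<^sub>1 + g\<^sub>2\<close> so that the integral of \<open>g\<^sub>1\<close> over \<open>(x, 1]\<close> vanishes for \<open>x \<ge> 1/4\<close>,
  that of \<open>g\<^sub>2\<close> vanishes for \<open>x < 1/4\<close>, and all mixed moments of \<open>g\<^sub>0, g\<^sub>1, g\<^sub>2\<close> are nonnegative.
  In the expansion of \<open>F\<close> into \<open>3\<^sup>d\<close> tensor products, the indicator of each point is orthogonal to all
  terms except those of a subproduct with only two summands per coordinate. Discarding these terms
  makes \<open>F\<close> blind to the points; it cannot increase the \<open>L\<^sub>q\<close>-norm, because \<open>q\<close> is an even integer
  and the moments are nonnegative; and each point costs only an exponentially small fraction of the
  pairing with \<open>\<Prod>i. t\<^sub>i\<close>.
\<close>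

section \<open>Integration and folding on the unit interval\<close>

abbreviation unit_interval :: "real measure" where
  "unit_interval \<equiv> restrict_space lborel {0..1}"

lemma prob_space_unit_interval: "prob_space unit_interval"
  by (rule prob_space_restrict_space) auto

interpretation unit_interval: prob_space unit_interval
  by (rule prob_space_unit_interval)

interpretation unit_cube: product_prob_space "\<lambda>_::nat. unit_interval" UNIV
  by unfold_locales

lemma prob_space_unit_cube: "prob_space (unit_cube d)"
  unfolding unit_cube_def by (intro prob_space_PiM prob_space_unit_interval)

lemma integrable_unit_interval_bounded:
  fixes f :: "real \<Rightarrow> real"
  assumes "f \<in> borel_measurable borel" "\<And>t. \<lbrakk>0 \<le> t; t \<le> 1\<rbrakk> \<Longrightarrow> \<bar>f t\<bar> \<le> B"
  shows "integrable unit_interval f"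
proof (rule unit_interval.integrable_const_bound)
  show "AE x in unit_interval. norm (f x) \<le> B"
    by (rule AE_I2) (use assms(2) in \<open>auto simp: space_restrict_space\<close>)
  show "f \<in> borel_measurable unit_interval"
    by (rule measurable_restrict_space1) (use assms(1) in simp)
qed

lemma integral_unit_interval_powr:
  assumes "s > 0" "0 \<le> c" "c \<le> 1"
  shows "(\<integral>t. (if t \<le> c then t powr s else 0) \<partial>unit_interval) = c powr (s + 1) / (s + 1)"
proof -
  have "((\<lambda>t. t powr s) has_integral (c powr (s + 1) / (s + 1))) {0..c}"
    using assms by (intro has_integral_powr_from_0) auto
  have "continuous_on {0..c} (\<lambda>t. t powr s)"
    using assms by (intro continuous_on_powr' continuous_intros) auto
  hence "set_integrable lborel {0..c} (\<lambda>t. t powr s)"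
    by (intro borel_integrable_atLeastAtMost') auto
  from set_borel_integral_eq_integral(2)[OF this]
  have "(LINT t:{0..c}|lborel. t powr s) = c powr (s + 1) / (s + 1)"
    using \<open>(_ has_integral _) _\<close> by (simp add: integral_unique)
  moreover have "(\<integral>t. (if t \<le> c then t powr s else 0) \<partial>unit_interval)
      = (LINT t:{0..c}|lborel. t powr s)"
    unfolding set_lebesgue_integral_def using assms
    by (subst integral_restrict_space) (auto intro!: Bochner_Integration.integral_cong simp: indicator_def)
  ultimately show ?thesis by simp
qed

text \<open>Translation by 1/2 carries \<open>(1/4, 1/2]\<close> onto \<open>(3/4, 1]\<close>, so
  the contributions of both quarters can be added pointwise on the left one. This lets negative
  values on \<open>(1/4, 1/2]\<close> be compensated by the values on
  \<open>(3/4, 1]\<close>.\<close>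

lemma integral_unit_interval_fold:
  fixes h :: "real \<Rightarrow> real"
  assumes [measurable]: "h \<in> borel_measurable borel"
    and B: "\<And>t. \<lbrakk>0 \<le> t; t \<le> 1\<rbrakk> \<Longrightarrow> \<bar>h t\<bar> \<le> B"
  shows "(\<integral>t. h t \<partial>unit_interval)
    = (\<integral>t. (if 1/4 < t \<and> t \<le> 1/2 then h t + h (t + 1/2) else if t \<le> 1/4 \<or> 1/2 < t \<and> t \<le> 3/4 then h t else 0)
         \<partial>unit_interval)"
proof -
  let ?L = "\<lambda>t::real. 1/4 < t \<and> t \<le> 1/2" and ?R = "\<lambda>t::real. 3/4 < t \<and> t \<le> 1"
  let ?O = "\<lambda>t::real. t \<le> 1/4 \<or> 1/2 < t \<and> t \<le> 3/4"
  have B0: "B \<ge> 0" using B[of 0] by auto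
  note int = integrable_unit_interval_bounded[where B = B]
  have iL: "integrable unit_interval (\<lambda>t. if ?L t then h t else 0)"
    and iR: "integrable unit_interval (\<lambda>t. if ?R t then h t else 0)"
    and iO: "integrable unit_interval (\<lambda>t. if ?O t then h t else 0)"
    and iL': "integrable unit_interval (\<lambda>t. if ?L t then h (t + 1/2) else 0)"
    using B0 B by (auto intro!: int)
  have shift: "(\<integral>t. (if ?R t then h t else 0) \<partial>unit_interval) = (\<integral>t. (if ?L t then h (t + 1/2) else 0) \<partial>unit_interval)"
  proof -
    have "(\<integral>t. (if ?R t then h t else 0) \<partial>unit_interval) = (\<integral>t. (if ?R t then h t else 0) \<partial>lborel)"
      by (subst integral_restrict_space) (auto intro!: Bochner_Integration.integral_cong simp: indicator_def)
    also have "\<dots> = (\<integral>t. (if ?R (1/2 + 1 * t) then h (1/2 + 1 * t) else 0) \<partial>lborel)"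
      by (subst lborel_integral_real_affine[where c = 1 and t = "1/2"]) auto
    also have "\<dots> = (\<integral>t. (if ?L t then h (t + 1/2) else 0) \<partial>lborel)"
      by (rule Bochner_Integration.integral_cong) (auto simp: add.commute)
    also have "\<dots> = (\<integral>t. (if ?L t then h (t + 1/2) else 0) \<partial>unit_interval)"
      by (subst integral_restrict_space) (auto intro!: Bochner_Integration.integral_cong simp: indicator_def)
    finally show ?thesis .
  qed
  have "(\<integral>t. h t \<partial>unit_interval) = (\<integral>t. (if ?O t then h t else 0) + ((if ?L t then h t else 0) + (if ?R t then h t else 0)) \<partial>unit_interval)"
    by (rule Bochner_Integration.integral_cong) (auto simp: space_restrict_space)
  also have "\<dots> = (\<integral>t. (if ?O t then h t else 0) + ((if ?L t then h t else 0) + (if ?L t then h (t + 1/2) else 0)) \<partial>unit_interval)"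
    using iL iR iO iL' shift by simp
  also have "\<dots> = (\<integral>t. (if ?L t then h t + h (t + 1/2) else if ?O t then h t else 0) \<partial>unit_interval)"
    by (rule Bochner_Integration.integral_cong) auto
  finally show ?thesis .
qed

section \<open>The three pieces: moments, masses and tails\<close>

text \<open>
  The gap is as large as possible such that \<open>\<bar>piece s c t\<bar> \<le> piece s c (t + 1/2)\<close> for \<open>t\<close> in
  \<open>(1/4, 1/2]\<close>, the only interval where a piece is negative. Hence \<open>(3/4, 1]\<close> outweighs \<open>(1/4, 1/2]\<close>
  in every mixed moment.
\<close>

definition gap :: "real \<Rightarrow> real" where
  "gap s = ((3/4) powr s - (1/2) powr s) / 2"

text \<open>The cases 0, 1 and 2 are the three summands of \<open>t powr s\<close>. Piece 1 lives on
  \<open>t \<le> 1/4\<close>, hence is invisible from any \<open>x \<ge> 1/4\<close>. Piece 2 takes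
  opposite values at \<open>t\<close> and \<open>t + 1/2\<close>, so it integrates to zero, and its
  support lies to the right of 1/4. Piece 0 is what remains. Labels above 2 repeat piece 2, which
  keeps bounds valid for all \<open>c\<close>.\<close>

definition piece :: "real \<Rightarrow> nat \<Rightarrow> real \<Rightarrow> real" where
  "piece s c t =
    (if c = 0 then
       (if t \<le> 1/4 then 0 else if t \<le> 1/2 then t powr s + gap s
        else if t \<le> 3/4 then t powr s else t powr s - gap s)
     else if c = 1 then (if t \<le> 1/4 then t powr s else 0)
     else (if 1/4 < t \<and> t \<le> 1/2 then - gap s else if 3/4 < t then gap s else 0))"

lemma gap_pos: "s > 0 \<Longrightarrow> gap s > 0"
  by (simp add: gap_def powr_less_mono2)

lemma gap_le: "s > 0 \<Longrightarrow> gap s \<le> 1/2"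
proof -
  assume "s > 0"
  hence "(3/4::real) powr s \<le> 1" by (simp add: powr_le1)
  moreover have "(1/2::real) powr s \<ge> 0" by simp
  ultimately show ?thesis unfolding gap_def by argo
qed

lemma sum_piece: "(\<Sum>c<3. piece s c t) = t powr s"
  by (simp add: piece_def numeral_3_eq_3)

lemma borel_measurable_piece [measurable]: "piece s c \<in> borel_measurable borel"
  unfolding piece_def by measurable

lemma piece_shift:
  assumes "s > 0" "1/4 < t" "t \<le> 1/2"
  shows "\<bar>piece s c t\<bar> \<le> piece s c (t + 1/2)"
proof -
  have "t powr s \<le> (1/2) powr s" "(3/4) powr s \<le> (t + 1/2) powr s"
    using assms by (auto intro: powr_mono2)
  \<comment> \<open>The two powers differ by at least \<open>2 * gap s\<close>; piece 0 gains one
    gap at \<open>t\<close> and loses one at \<open>t + 1/2\<close>.\<close>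
  hence "t powr s + gap s \<le> (t + 1/2) powr s - gap s"
    unfolding gap_def by argo
  moreover have "t powr s + gap s \<ge> 0"
    using gap_pos[OF assms(1)] by (simp add: add_nonneg_nonneg)
  ultimately show ?thesis
    using assms gap_pos[OF assms(1)] by (auto simp: piece_def)
qed

lemma piece_nonneg:
  assumes "s > 0" "t \<le> 1/4 \<or> 1/2 < t"
  shows "piece s c t \<ge> 0"
proof (cases "3/4 < t")
  case True
  hence "(3/4) powr s \<le> t powr s" using assms by (auto intro: powr_mono2)
  moreover have "(3/4) powr s \<ge> gap s"
  proof -
    have "(1/2::real) powr s \<ge> 0" "(3/4::real) powr s \<ge> 0" by simp_all
    thus ?thesis unfolding gap_def by argo
  qed
  ultimately show ?thesis using True gap_pos[OF assms(1)] by (auto simp: piece_def)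
qed (use assms gap_pos[OF assms(1)] in \<open>auto simp: piece_def\<close>)

lemma piece_bounded:
  assumes "s > 0" "0 \<le> t" "t \<le> 1"
  shows "\<bar>piece s c t\<bar> \<le> 2"
proof -
  have "t powr s \<le> 1" using assms by (simp add: powr_le1)
  moreover have "0 \<le> t powr s" by simp
  ultimately show ?thesis
    using gap_pos[OF assms(1)] gap_le[OF assms(1)] by (simp add: piece_def abs_if del: powr_ge_zero)
qed

text \<open>After folding, the integrand is nonnegative pointwise: by \<open>piece_shift\<close>,
  applied factor by factor, the product at \<open>t + 1/2\<close> dominates the absolute value of
  the product at \<open>t\<close> in \<open>(1/4, 1/2]\<close>; elsewhere all factors are
  nonnegative.\<close>

lemma piece_moment_nonneg:
  assumes "s > 0"
  shows "(\<integral>t. (\<Prod>j\<in>J. piece s (w j) t) \<partial>unit_interval) \<ge> 0"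
proof -
  let ?P = "\<lambda>t. \<Prod>j\<in>J. piece s (w j) t"
  have bound: "\<bar>?P t\<bar> \<le> 2 ^ card J" if "0 \<le> t" "t \<le> 1" for t
  proof -
    have "\<bar>?P t\<bar> \<le> (\<Prod>j\<in>J. 2)"
      unfolding abs_prod by (intro prod_mono) (use piece_bounded[OF assms that] in auto)
    thus ?thesis by simp
  qed
  have shift: "?P t + ?P (t + 1/2) \<ge> 0" if "1/4 < t" "t \<le> 1/2" for t
  proof -
    have "\<bar>?P t\<bar> \<le> ?P (t + 1/2)"
      unfolding abs_prod by (intro prod_mono) (use piece_shift[OF assms that] in auto)
    thus ?thesis by linarith
  qed
  have "(\<integral>t. ?P t \<partial>unit_interval) = (\<integral>t. (if 1/4 < t \<and> t \<le> 1/2 then ?P t + ?P (t + 1/2)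
      else if t \<le> 1/4 \<or> 1/2 < t \<and> t \<le> 3/4 then ?P t else 0) \<partial>unit_interval)"
    by (rule integral_unit_interval_fold[where B = "2 ^ card J"]) (use bound in auto)
  also have "\<dots> \<ge> 0"
    by (rule Bochner_Integration.integral_nonneg)
       (use shift piece_nonneg[OF assms] in \<open>auto intro!: prod_nonneg\<close>)
  finally show ?thesis .
qed

text \<open>By Fubini, products of these numbers over the coordinates are the pairings of the volume
  term \<open>\<Prod>i<d. t i\<close> with the tensor products.\<close>

definition piece_mass :: "real \<Rightarrow> nat \<Rightarrow> real" where
  "piece_mass s c = (\<integral>t. t * piece s c t \<partial>unit_interval)"

lemma abs_mult_piece_le: "\<lbrakk>s > 0; 0 \<le> t; t \<le> 1\<rbrakk> \<Longrightarrow> \<bar>t * piece s c t\<bar> \<le> 2"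
  using mult_mono[of "\<bar>t\<bar>" 1 "\<bar>piece s c t\<bar>" 2] piece_bounded[of s t c] by (simp add: abs_mult)

lemma integrable_mult_piece: "s > 0 \<Longrightarrow> integrable unit_interval (\<lambda>t. t * piece s c t)"
  by (rule integrable_unit_interval_bounded[where B = 2]) (auto intro: abs_mult_piece_le)

lemma sum_piece_mass:
  assumes "s > 0"
  shows "(\<Sum>c<3. piece_mass s c) = 1 / (s + 2)"
proof -
  have "(\<Sum>c<3. piece_mass s c) = (\<integral>t. (\<Sum>c<3. t * piece s c t) \<partial>unit_interval)"
    unfolding piece_mass_def using integrable_mult_piece[OF assms] by simp
  also have "\<dots> = (\<integral>t. (if t \<le> 1 then t powr (s + 1) else 0) \<partial>unit_interval)"
    by (rule Bochner_Integration.integral_cong)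
       (use assms in \<open>auto simp: space_restrict_space sum_piece powr_mult_base add.commute simp flip: sum_distrib_left\<close>)
  also have "\<dots> = 1 / (s + 2)"
    using integral_unit_interval_powr[of "s + 1" 1] assms by (simp add: add.commute)
  finally show ?thesis .
qed

lemma piece_mass_nonneg_0: "s > 0 \<Longrightarrow> piece_mass s 0 \<ge> 0"
proof -
  assume s: "s > 0"
  have "piece s 0 t \<ge> 0" for t
    using piece_nonneg[OF s, of t 0] gap_pos[OF s] by (cases "t \<le> 1/4 \<or> 1/2 < t") (auto simp: piece_def intro: add_nonneg_nonneg)
  thus ?thesis unfolding piece_mass_def
    by (intro Bochner_Integration.integral_nonneg) (auto simp: space_restrict_space)
qed

lemma piece_mass_pos_1: "s > 0 \<Longrightarrow> piece_mass s 1 > 0"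
proof -
  assume s: "s > 0"
  have "piece_mass s 1 = (\<integral>t. (if t \<le> 1/4 then t powr (s + 1) else 0) \<partial>unit_interval)"
    unfolding piece_mass_def
    by (rule Bochner_Integration.integral_cong)
       (use s in \<open>auto simp: space_restrict_space piece_def powr_mult_base add.commute\<close>)
  also have "\<dots> > 0"
    using integral_unit_interval_powr[of "s + 1" "1/4"] s by simp
  finally show ?thesis .
qed

lemma integral_unit_interval_quarter:
  fixes c :: real
  shows "(\<integral>t. (if 1/4 < t \<and> t \<le> 1/2 then c else 0) \<partial>unit_interval) = c / 4"
proof -
  have "(\<integral>t. (if 1/4 < t \<and> t \<le> 1/2 then c else 0) \<partial>unit_interval)
      = (\<integral>t. c * indicator {1/4<..1/2::real} t \<partial>lborel)"
    by (subst integral_restrict_space, simp, rule Bochner_Integration.integral_cong) (auto simp: indicator_def)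
  also have "\<dots> = c / 4"
    by (simp add: measure_def)
  finally show ?thesis .
qed

lemma integral_piece_2: "s > 0 \<Longrightarrow> (\<integral>t. piece s 2 t \<partial>unit_interval) = 0"
  by (subst integral_unit_interval_fold[where B = 2])
     (auto simp: piece_bounded, auto intro!: integral_eq_zero_AE AE_I2 simp: piece_def)

text \<open>The positive values of piece 2 sit 1/2 to the right of the negative ones, so the weight
  \<open>t\<close> favours them: folding leaves the constant \<open>gap s / 2\<close> on
  \<open>(1/4, 1/2]\<close>.\<close>

lemma piece_mass_pos_2: "s > 0 \<Longrightarrow> piece_mass s 2 > 0"
proof -
  assume s: "s > 0"
  have "piece_mass s 2 = (\<integral>t. (if 1/4 < t \<and> t \<le> 1/2 then t * piece s 2 t + (t + 1/2) * piece s 2 (t + 1/2)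
      else if t \<le> 1/4 \<or> 1/2 < t \<and> t \<le> 3/4 then t * piece s 2 t else 0) \<partial>unit_interval)"
    unfolding piece_mass_def
    by (rule integral_unit_interval_fold[where B = 2]) (use abs_mult_piece_le[OF s] in auto)
  also have "\<dots> = (\<integral>t. (if 1/4 < t \<and> t \<le> 1/2 then gap s / 2 else 0) \<partial>unit_interval)"
    by (rule Bochner_Integration.integral_cong) (auto simp: piece_def algebra_simps)
  also have "\<dots> = gap s / 2 / 4" by (rule integral_unit_interval_quarter)
  finally show ?thesis using gap_pos[OF s] by simp
qed

text \<open>The only label left is 2 if \<open>x < 1/4\<close> and 1 otherwise. In the first case
  the indicator is 1 on the whole support of piece 2, whose integral is zero; in the second the tail
  misses the support of piece 1.\<close>

lemma integral_piece_tail: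
  assumes "s > 0" "c \<noteq> 0" "c \<noteq> (if x < 1/4 then 1 else 2)" "c < 3"
  shows "(\<integral>t. (if x < t then 1 else 0) * piece s c t \<partial>unit_interval) = 0"
proof (cases "x < 1/4")
  case True
  hence "c = 2" using assms by auto
  have "(\<integral>t. (if x < t then 1 else 0) * piece s c t \<partial>unit_interval) = (\<integral>t. piece s 2 t \<partial>unit_interval)"
    by (rule Bochner_Integration.integral_cong) (use True \<open>c = 2\<close> in \<open>auto simp: piece_def\<close>)
  thus ?thesis using integral_piece_2[OF assms(1)] by simp
next
  case False
  hence "c = 1" using assms by auto
  thus ?thesis using False
    by (intro integral_eq_zero_AE AE_I2) (auto simp: piece_def)
qed

section \<open>Integration on the unit cube\<close>

lemma space_unit_cube: "space (unit_cube d) = PiE {..<d} (\<lambda>_. {0..1})"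
  by (simp add: unit_cube_def space_PiM space_restrict_space)

lemma measurable_unit_cube_component [measurable]:
  assumes "i < d"
  shows "(\<lambda>t. t i) \<in> borel_measurable (unit_cube d)"
proof -
  have "(\<lambda>t. t i) \<in> measurable (unit_cube d) unit_interval"
    unfolding unit_cube_def by (rule measurable_component_singleton) (use assms in simp)
  from measurable_compose[OF this, of "\<lambda>x. x" borel] show ?thesis
    by (simp add: measurable_restrict_space1)
qed

lemma integrable_unit_cube_bounded:
  fixes f :: "(nat \<Rightarrow> real) \<Rightarrow> real"
  assumes "f \<in> borel_measurable (unit_cube d)"
    and "\<And>t. t \<in> space (unit_cube d) \<Longrightarrow> \<bar>f t\<bar> \<le> B"
  shows "integrable (unit_cube d) f"
proof -
  interpret prob_space "unit_cube d" by (rule prob_space_unit_cube)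
  show ?thesis
    by (rule integrable_const_bound[of _ B]) (use assms in auto)
qed

lemma
  fixes f :: "nat \<Rightarrow> real \<Rightarrow> real"
  assumes "\<And>i. i < d \<Longrightarrow> integrable unit_interval (f i)"
  shows integrable_unit_cube_prod: "integrable (unit_cube d) (\<lambda>t. \<Prod>i<d. f i (t i))"
    and integral_unit_cube_prod:
      "(\<integral>t. (\<Prod>i<d. f i (t i)) \<partial>unit_cube d) = (\<Prod>i<d. \<integral>u. f i u \<partial>unit_interval)"
  unfolding unit_cube_def
  by (rule unit_cube.product_integrable_prod unit_cube.product_integral_prod; use assms in simp)+

section \<open>Duality and basic bounds for the discrepancy function\<close>

text \<open>A form of Hoelder's inequality that avoids roots: testing \<open>f\<close> against a dual function \<open>g\<close>.\<close>

lemma powr_integral_ge_dual: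
  fixes f g :: "'a \<Rightarrow> real"
  assumes pq: "p > 1" "q > 1" "1 / p + 1 / q = 1"
    and int: "integrable M (\<lambda>x. \<bar>f x\<bar> powr p)" "integrable M (\<lambda>x. \<bar>g x\<bar> powr q)"
      "integrable M (\<lambda>x. f x * g x)"
    and g: "(\<integral>x. \<bar>g x\<bar> powr q \<partial>M) \<le> K"
    and fg: "\<theta> * K \<le> \<bar>\<integral>x. f x * g x \<partial>M\<bar>" and "\<theta> \<ge> 0"
  shows "\<theta> powr p * K \<le> (\<integral>x. \<bar>f x\<bar> powr p \<partial>M)"
proof -
  \<comment> \<open>This scaling of \<open>g\<close> in Young's inequality gives both
    \<open>c powr q = \<theta> powr p\<close> and \<open>c * \<theta> = \<theta> powr p\<close>, so
    the terms with \<open>K\<close> on the two sides carry the same factor and can be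
    subtracted.\<close>
  define c where "c = \<theta> powr (p - 1)"
  have "(p - 1) * q = p" using pq by (simp add: field_simps)
  hence cq: "c powr q = \<theta> powr p" by (simp add: c_def powr_powr)
  have c\<theta>: "c * \<theta> = \<theta> powr p"
    using powr_mult_base[of \<theta> "p - 1"] \<open>\<theta> \<ge> 0\<close> by (simp add: c_def mult.commute)
  have "c \<ge> 0" by (simp add: c_def)
  have young: "c * \<bar>f x * g x\<bar> \<le> \<bar>f x\<bar> powr p / p + \<theta> powr p * \<bar>g x\<bar> powr q / q" for x
    using Youngs_inequality[OF pq, of "\<bar>f x\<bar>" "c * \<bar>g x\<bar>"] \<open>c \<ge> 0\<close>
    by (simp add: abs_mult powr_mult cq mult_ac)
  have "\<theta> powr p * K = c * (\<theta> * K)" by (simp flip: c\<theta>)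
  also have "\<dots> \<le> c * \<bar>\<integral>x. f x * g x \<partial>M\<bar>"
    using fg \<open>c \<ge> 0\<close> by (rule mult_left_mono)
  also have "\<dots> \<le> c * (\<integral>x. \<bar>f x * g x\<bar> \<partial>M)"
    using \<open>c \<ge> 0\<close> by (intro mult_left_mono integral_abs_bound)
  also have "\<dots> = (\<integral>x. c * \<bar>f x * g x\<bar> \<partial>M)" by simp
  also have "\<dots> \<le> (\<integral>x. \<bar>f x\<bar> powr p / p + \<theta> powr p * \<bar>g x\<bar> powr q / q \<partial>M)"
    using int young by (intro integral_mono) auto
  also have "\<dots> = (\<integral>x. \<bar>f x\<bar> powr p \<partial>M) / p + \<theta> powr p * (\<integral>x. \<bar>g x\<bar> powr q \<partial>M) / q"
    using int by simp
  also have "\<dots> \<le> (\<integral>x. \<bar>f x\<bar> powr p \<partial>M) / p + \<theta> powr p * K / q"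
    using g pq by (intro add_left_mono divide_right_mono mult_left_mono) auto
  finally have "\<theta> powr p * K * (1 - 1 / q) \<le> (\<integral>x. \<bar>f x\<bar> powr p \<partial>M) / p"
    by (simp add: algebra_simps)
  also have "1 - 1 / q = 1 / p" using pq by simp
  finally show ?thesis using pq by (simp add: field_simps)
qed

text \<open>Writing the box indicator as a product over coordinates opens it to Fubini and to
  measurability coordinate by coordinate.\<close>

lemma if_ball_eq_prod:
  "(if \<forall>i<d. P i then 1 else 0 :: real) = (\<Prod>i<d. if P i then 1 else 0)" for d :: nat
  by (induction d) (auto simp: less_Suc_eq)

lemma prod_unit_cube_bounds:
  assumes "t \<in> space (unit_cube d)"
  shows "0 \<le> (\<Prod>i<d. t i)" "(\<Prod>i<d. t i) \<le> 1"
  using assms by (auto simp: space_unit_cube PiE_iff intro!: prod_nonneg prod_le_1)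

lemma borel_measurable_gen_disc_fun [measurable]:
  "gen_disc_fun d N x a \<in> borel_measurable (unit_cube d)"
  unfolding gen_disc_fun_def if_ball_eq_prod
  by (intro borel_measurable_diff borel_measurable_sum borel_measurable_times borel_measurable_prod
        measurable_If borel_measurable_const) measurable

lemma abs_gen_disc_fun_le:
  assumes "t \<in> space (unit_cube d)"
  shows "\<bar>gen_disc_fun d N x a t\<bar> \<le> (\<Sum>k<N. \<bar>a k\<bar>) + 1"
proof -
  have "\<bar>gen_disc_fun d N x a t\<bar>
      \<le> \<bar>\<Sum>k<N. a k * (if \<forall>i<d. 0 \<le> x k i \<and> x k i < t i then 1 else 0)\<bar> + \<bar>\<Prod>i<d. t i\<bar>"
    unfolding gen_disc_fun_def by (rule abs_triangle_ineq4)
  also have "\<dots> \<le> (\<Sum>k<N. \<bar>a k\<bar>) + 1"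
    using prod_unit_cube_bounds[OF assms]
    by (intro add_mono order.trans[OF sum_abs] sum_mono) auto
  finally show ?thesis .
qed

section \<open>Tensor products of pieces\<close>

definition tensor :: "nat \<Rightarrow> real \<Rightarrow> (nat \<Rightarrow> nat) \<Rightarrow> (nat \<Rightarrow> real) \<Rightarrow> real" where
  "tensor d s v t = (\<Prod>i<d. piece s (v i) (t i))"

lemma borel_measurable_tensor [measurable]: "tensor d s v \<in> borel_measurable (unit_cube d)"
  unfolding tensor_def by (intro borel_measurable_prod) measurable

lemma abs_tensor_le:
  assumes "s > 0" "t \<in> space (unit_cube d)"
  shows "\<bar>tensor d s v t\<bar> \<le> 2 ^ d"
proof -
  have "\<bar>tensor d s v t\<bar> \<le> (\<Prod>i<d. 2)"
    unfolding tensor_def abs_prod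
    by (intro prod_mono) (use assms in \<open>auto intro!: piece_bounded simp: space_unit_cube PiE_iff\<close>)
  thus ?thesis by simp
qed

lemma abs_sum_tensor_le:
  assumes "s > 0" "t \<in> space (unit_cube d)"
  shows "\<bar>\<Sum>v\<in>S. tensor d s v t\<bar> \<le> real (card S) * 2 ^ d"
proof -
  have "\<bar>\<Sum>v\<in>S. tensor d s v t\<bar> \<le> (\<Sum>v\<in>S. 2 ^ d)"
    by (intro order.trans[OF sum_abs] sum_mono abs_tensor_le assms)
  thus ?thesis by simp
qed

lemma integrable_piece_prod:
  assumes "s > 0"
  shows "integrable unit_interval (\<lambda>u. \<Prod>j\<in>J. piece s (w j) u)"
proof (rule integrable_unit_interval_bounded[where B = "2 ^ card J"])
  fix t :: real assume "0 \<le> t" "t \<le> 1"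
  hence "\<bar>\<Prod>j\<in>J. piece s (w j) t\<bar> \<le> (\<Prod>j\<in>J. 2)"
    unfolding abs_prod by (intro prod_mono) (use piece_bounded[OF assms] in auto)
  thus "\<bar>\<Prod>j\<in>J. piece s (w j) t\<bar> \<le> 2 ^ card J" by simp
qed simp

text \<open>Expanding the power yields a sum over \<open>n\<close>-tuples of labels, each term a
  product of one-dimensional mixed moments. These are nonnegative, so a smaller label set only drops
  nonnegative terms.\<close>

lemma integral_sum_tensor_power_mono:
  assumes "s > 0" "finite T" "S \<subseteq> T"
  shows "(\<integral>t. (\<Sum>v\<in>S. tensor d s v t) ^ n \<partial>unit_cube d) \<le> (\<integral>t. (\<Sum>v\<in>T. tensor d s v t) ^ n \<partial>unit_cube d)"
proof -
  let ?m = "\<lambda>V. \<Prod>i<d. \<integral>u. (\<Prod>j<n. piece s (V j i) u) \<partial>unit_interval"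
  have expand: "(\<integral>t. (\<Sum>v\<in>S. tensor d s v t) ^ n \<partial>unit_cube d) = (\<Sum>V\<in>PiE {..<n} (\<lambda>_. S). ?m V)"
    if "finite S" for S
  proof -
    have "(\<Sum>v\<in>S. tensor d s v t) ^ n
        = (\<Sum>V\<in>PiE {..<n} (\<lambda>_. S). \<Prod>i<d. \<Prod>j<n. piece s (V j i) (t i))" for t
    proof -
      have "(\<Sum>v\<in>S. tensor d s v t) ^ n = (\<Prod>j<n. \<Sum>v\<in>S. tensor d s v t)" by simp
      also have "\<dots> = (\<Sum>V\<in>PiE {..<n} (\<lambda>_. S). \<Prod>j<n. tensor d s (V j) t)"
        by (rule prod_sum_PiE) (use that in auto)
      also have "\<dots> = (\<Sum>V\<in>PiE {..<n} (\<lambda>_. S). \<Prod>i<d. \<Prod>j<n. piece s (V j i) (t i))"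
        unfolding tensor_def by (intro sum.cong refl prod.swap)
      finally show ?thesis .
    qed
    moreover have "integrable (unit_cube d) (\<lambda>t. \<Prod>i<d. \<Prod>j<n. piece s (V j i) (t i))"
      "(\<integral>t. (\<Prod>i<d. \<Prod>j<n. piece s (V j i) (t i)) \<partial>unit_cube d) = ?m V" for V
      by (intro integrable_unit_cube_prod integral_unit_cube_prod integrable_piece_prod assms(1))+
    ultimately show ?thesis
      by (simp only: Bochner_Integration.integral_sum)
  qed
  have "finite S" using assms by (auto intro: finite_subset)
  have "(\<Sum>V\<in>PiE {..<n} (\<lambda>_. S). ?m V) \<le> (\<Sum>V\<in>PiE {..<n} (\<lambda>_. T). ?m V)"
  proof (rule sum_mono2)
    show "finite (PiE {..<n} (\<lambda>_. T))" using assms by (intro finite_PiE) auto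
    show "PiE {..<n} (\<lambda>_. S) \<subseteq> PiE {..<n} (\<lambda>_. T)" using assms by (intro PiE_mono) auto
  qed (auto intro!: prod_nonneg piece_moment_nonneg assms)
  thus ?thesis using expand[OF \<open>finite S\<close>] expand[OF \<open>finite T\<close>] by simp
qed

abbreviation labels :: "nat \<Rightarrow> (nat \<Rightarrow> nat) set" where
  "labels d \<equiv> PiE {..<d} (\<lambda>_. {..<3})"

lemma finite_labels: "finite (labels d)"
  by (intro finite_PiE) auto

text \<open>By distributivity, the sum over all labels is again the product of the
  \<open>t i powr s\<close>, so the integral factors into one-dimensional power integrals.\<close>

lemma integral_full_tensor_power:
  assumes "s > 0" "n > 0"
  shows "(\<integral>t. (\<Sum>v\<in>labels d. tensor d s v t) ^ n \<partial>unit_cube d) = (1 / (s * n + 1)) ^ d"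
proof -
  have int1: "(\<integral>u. (u powr s) ^ n \<partial>unit_interval) = 1 / (s * n + 1)"
  proof -
    have "(\<integral>u. (u powr s) ^ n \<partial>unit_interval) = (\<integral>u. (if u \<le> 1 then u powr (s * n) else 0) \<partial>unit_interval)"
      by (rule Bochner_Integration.integral_cong)
         (use assms in \<open>auto simp: space_restrict_space powr_powr simp flip: powr_realpow'\<close>)
    thus ?thesis using integral_unit_interval_powr[of "s * n" 1] assms by simp
  qed
  have "integrable unit_interval (\<lambda>u. (u powr s) ^ n)"
    by (rule integrable_unit_interval_bounded[where B = 1])
       (use assms in \<open>auto intro!: power_le_one powr_le1\<close>)
  note * = integral_unit_cube_prod[OF this]
  have "(\<Sum>v\<in>labels d. tensor d s v t) ^ n = (\<Prod>i<d. (t i powr s) ^ n)" for t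
  proof -
    have "(\<Sum>v\<in>labels d. tensor d s v t) = (\<Prod>i<d. \<Sum>c<3. piece s c (t i))"
      unfolding tensor_def by (rule prod_sum_PiE[symmetric]) auto
    thus ?thesis by (simp add: sum_piece prod_power_distrib)
  qed
  thus ?thesis using * int1 by simp
qed

lemma integral_prod_times_tensor:
  assumes "s > 0"
  shows "(\<integral>t. (\<Prod>i<d. t i) * tensor d s v t \<partial>unit_cube d) = (\<Prod>i<d. piece_mass s (v i))"
  using integral_unit_cube_prod[of d "\<lambda>i u. u * piece s (v i) u"] integrable_mult_piece[OF assms]
  by (simp add: tensor_def piece_mass_def prod.distrib)

text \<open>The integral factors over the coordinates, so a single coordinate with a vanishing tail
  integral suffices.\<close>

lemma integral_box_times_tensor:
  assumes "s > 0" "i < d" "0 \<le> x i" "v i < 3" "v i \<noteq> 0" "v i \<noteq> (if x i < 1/4 then 1 else 2)"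
  shows "(\<integral>t. (if \<forall>i<d. 0 \<le> x i \<and> x i < t i then 1 else 0) * tensor d s v t \<partial>unit_cube d) = 0"
proof -
  let ?f = "\<lambda>i u. (if 0 \<le> x i \<and> x i < u then 1 else 0) * piece s (v i) u"
  have "integrable unit_interval (?f j)" for j
    by (rule integrable_unit_interval_bounded[where B = 2]) (auto intro: piece_bounded assms)
  hence "(\<integral>t. (if \<forall>i<d. 0 \<le> x i \<and> x i < t i then 1 else 0) * tensor d s v t \<partial>unit_cube d)
      = (\<Prod>j<d. \<integral>u. ?f j u \<partial>unit_interval)"
    using integral_unit_cube_prod[of d ?f] by (simp add: tensor_def prod.distrib if_ball_eq_prod)
  also have "(\<integral>u. ?f i u \<partial>unit_interval) = 0"
    using integral_piece_tail[of s "v i" "x i"] assms by simp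
  hence "(\<Prod>j<d. \<integral>u. ?f j u \<partial>unit_interval) = 0"
    using assms(2) by (intro prod_zero) auto
  finally show ?thesis .
qed

section \<open>Lower bound for the discrepancy of N points\<close>

lemma sum_UN_le:
  fixes f :: "'a \<Rightarrow> real" and N :: nat
  assumes "\<And>k. finite (A k)" "\<And>x. f x \<ge> 0"
  shows "sum f (\<Union>k<N. A k) \<le> (\<Sum>k<N. sum f (A k))"
proof (induction N)
  case (Suc N)
  have "sum f (\<Union>k<Suc N. A k) = sum f ((\<Union>k<N. A k) \<union> A N)"
    by (simp add: lessThan_Suc Un_commute)
  also have "\<dots> \<le> sum f (\<Union>k<N. A k) + sum f (A N)"
    using sum_Un[of "\<Union>k<N. A k" "A N" f] assms by (simp add: sum_nonneg)
  finally show ?case using Suc by simp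
qed simp

text \<open>The share, per coordinate, of the total mass \<open>1 / (s + 2)\<close> that a single point can block.\<close>

definition mass_ratio :: "real \<Rightarrow> real" where
  "mass_ratio s = (piece_mass s 0 + max (piece_mass s 1) (piece_mass s 2)) * (s + 2)"

lemma piece_mass_sum3: "s > 0 \<Longrightarrow> piece_mass s 0 + piece_mass s 1 + piece_mass s 2 = 1 / (s + 2)"
  using sum_piece_mass[of s] by (simp add: numeral_3_eq_3 numeral_2_eq_2)

text \<open>The maximum omits one of the masses of pieces 1 and 2. Both are positive, hence the
  strict inequality.\<close>

lemma mass_ratio_bounds:
  assumes "s > 0"
  shows "0 < mass_ratio s" "mass_ratio s < 1"
proof -
  note m = piece_mass_nonneg_0[OF assms] piece_mass_pos_1[OF assms] piece_mass_pos_2[OF assms]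
    piece_mass_sum3[OF assms]
  show "0 < mass_ratio s"
    unfolding mass_ratio_def using m assms by (intro mult_pos_pos) auto
  have "piece_mass s 0 + max (piece_mass s 1) (piece_mass s 2) < 1 / (s + 2)"
    using m by auto
  thus "mass_ratio s < 1"
    unfolding mass_ratio_def using assms by (simp add: field_simps)
qed

text \<open>Here \<open>n\<close> is the exponent conjugate to \<open>s + 1\<close>. The test
  function \<open>F\<close> keeps the tensor products that every point's box annihilates separately,
  which makes the bound independent of the coefficients \<open>a\<close>.\<close>

lemma gen_Lp_disc_ge:
  fixes s :: real and n :: nat
  assumes s: "s > 0" and n: "even n" "s * n = s + 1"
    and x: "x \<in> point_sets d N"
    and \<theta>: "1 - real N * mass_ratio s ^ d \<ge> 0"
  shows "gen_Lp_disc (s + 1) d N x a \<ge> (1 - real N * mass_ratio s ^ d) * (s + 2) powr (- real d / (s + 1))"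
proof -
  let ?\<theta> = "1 - real N * mass_ratio s ^ d" and ?K = "(1 / (s + 2)) ^ d"
  let ?\<sigma> = "\<lambda>k i. if x k i < 1/4 then 1 else 2 :: nat"
  \<comment> \<open>Outside this set of labels, a tensor product integrates to zero over the box of
    point \<open>k\<close>.\<close>
  let ?R = "\<lambda>k. PiE {..<d} (\<lambda>i. {0, ?\<sigma> k i})"
  let ?D = "gen_disc_fun d N x a"
  let ?B = "\<lambda>k t. (if \<forall>i<d. 0 \<le> x k i \<and> x k i < t i then 1 else 0 :: real)"
  define S where "S = labels d - (\<Union>k<N. ?R k)"
  define F where "F = (\<lambda>t. \<Sum>v\<in>S. tensor d s v t)"
  define m where "m = (\<lambda>v. \<Prod>i<d. piece_mass s (v i))"
  have "n \<noteq> 0" using n s by (cases "n = 0") auto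
  have "s * real n > s" using n by simp
  hence "real n > 1" using s by simp
  have finS: "finite S" unfolding S_def using finite_labels by auto
  have F_meas [measurable]: "F \<in> borel_measurable (unit_cube d)"
    unfolding F_def by measurable
  have F_bound: "\<bar>F t\<bar> \<le> real (card S) * 2 ^ d" if "t \<in> space (unit_cube d)" for t
    unfolding F_def by (rule abs_sum_tensor_le[OF s that])
  define A where "A = (\<Sum>k<N. \<bar>a k\<bar>) + 1"
  have A: "A \<ge> 0" by (simp add: A_def sum_nonneg add_nonneg_nonneg)
  have D_bound: "\<bar>?D t\<bar> \<le> A" if "t \<in> space (unit_cube d)" for t
    unfolding A_def by (rule abs_gen_disc_fun_le[OF that])
  define B where "B = real (card S) * 2 ^ d"

  have F_norm: "(\<integral>t. \<bar>F t\<bar> powr real n \<partial>unit_cube d) \<le> ?K"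
  proof -
    have "(\<integral>t. \<bar>F t\<bar> powr real n \<partial>unit_cube d) = (\<integral>t. F t ^ n \<partial>unit_cube d)"
      \<comment> \<open>Evenness of \<open>n\<close> removes the absolute value, leaving a power
        that can be expanded.\<close>
      using n(1) \<open>n \<noteq> 0\<close> by (simp add: powr_realpow' power_even_abs)
    also have "\<dots> \<le> (\<integral>t. (\<Sum>v\<in>labels d. tensor d s v t) ^ n \<partial>unit_cube d)"
      unfolding F_def by (rule integral_sum_tensor_power_mono[OF s finite_labels]) (auto simp: S_def)
    also have "\<dots> = (1 / (s * n + 1)) ^ d"
      using \<open>n \<noteq> 0\<close> by (intro integral_full_tensor_power s) auto
    \<comment> \<open>Since \<open>s * n = s + 1\<close>, this is the same constant as the total
      mass of all labels in \<open>total\<close>; the only loss in the duality is thus the removed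
      mass.\<close>
    also have "\<dots> = ?K" using n by (simp add: add.assoc)
    finally show ?thesis .
  qed

  have int_t: "integrable (unit_cube d) (\<lambda>t. (\<Prod>i<d. t i) * tensor d s v t)" for v
  proof (rule integrable_unit_cube_bounded)
    show "(\<lambda>t. (\<Prod>i<d. t i) * tensor d s v t) \<in> borel_measurable (unit_cube d)"
      by (intro borel_measurable_times borel_measurable_prod) measurable
    show "\<bar>(\<Prod>i<d. t i) * tensor d s v t\<bar> \<le> 1 * 2 ^ d" if "t \<in> space (unit_cube d)" for t
      unfolding abs_mult using prod_unit_cube_bounds[OF that]
      by (intro mult_mono abs_tensor_le s that) auto
  qed
  have int_B: "integrable (unit_cube d) (\<lambda>t. ?B k t * tensor d s v t)" for k v
  proof (rule integrable_unit_cube_bounded)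
    show "(\<lambda>t. ?B k t * tensor d s v t) \<in> borel_measurable (unit_cube d)"
      unfolding if_ball_eq_prod
      by (intro borel_measurable_times borel_measurable_prod measurable_If borel_measurable_const) measurable
    show "\<bar>?B k t * tensor d s v t\<bar> \<le> 1 * 2 ^ d" if "t \<in> space (unit_cube d)" for t
      unfolding abs_mult by (intro mult_mono abs_tensor_le s that) auto
  qed

  have vanish: "(\<integral>t. ?B k t * tensor d s v t \<partial>unit_cube d) = 0" if "k < N" "v \<in> S" for k v
  proof -
    have v: "v \<in> labels d" "v \<notin> ?R k" using that by (auto simp: S_def)
    then obtain i where "i < d" "v i \<notin> {0, ?\<sigma> k i}"
      by (auto simp: PiE_iff)
    moreover have "v i < 3" "0 \<le> x k i"
      using v x \<open>i < d\<close> \<open>k < N\<close> by (auto simp: PiE_iff point_sets_def)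
    ultimately show ?thesis
      by (intro integral_box_times_tensor[OF s]) auto
  qed

  have pairing: "(\<integral>t. ?D t * F t \<partial>unit_cube d) = - (\<Sum>v\<in>S. m v)"
  proof -
    have "?D t * F t = (\<Sum>v\<in>S. (\<Sum>k<N. a k * (?B k t * tensor d s v t)) - (\<Prod>i<d. t i) * tensor d s v t)" for t
      by (simp add: gen_disc_fun_def F_def sum_distrib_left sum_distrib_right algebra_simps sum_subtractf) (rule sum.swap)
    hence "(\<integral>t. ?D t * F t \<partial>unit_cube d)
        = (\<Sum>v\<in>S. (\<Sum>k<N. a k * (\<integral>t. ?B k t * tensor d s v t \<partial>unit_cube d))
            - (\<integral>t. (\<Prod>i<d. t i) * tensor d s v t \<partial>unit_cube d))"
      using int_t int_B by (simp add: Bochner_Integration.integral_sum)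
    also have "\<dots> = (\<Sum>v\<in>S. - m v)"
      using vanish integral_prod_times_tensor[OF s] by (intro sum.cong) (auto simp: m_def)
    finally show ?thesis by (simp add: sum_negf)
  qed

  have m_nonneg: "m v \<ge> 0" if "v \<in> labels d" for v
  proof -
    have "piece_mass s c \<ge> 0" if "c < 3" for c
    proof -
      from that have "c = 0 \<or> c = 1 \<or> c = 2" by auto
      thus ?thesis
        using piece_mass_nonneg_0[OF s] piece_mass_pos_1[OF s] piece_mass_pos_2[OF s] by (auto simp: less_imp_le)
    qed
    thus ?thesis using that unfolding m_def by (auto intro!: prod_nonneg simp: PiE_iff)
  qed
  have total: "(\<Sum>v\<in>labels d. m v) = ?K"
  proof -
    have "(\<Sum>v\<in>labels d. m v) = (\<Prod>i<d. \<Sum>c<3. piece_mass s c)"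
      unfolding m_def by (rule prod_sum_PiE[symmetric]) auto
    thus ?thesis by (simp add: sum_piece_mass[OF s])
  qed
  have R_sub: "?R k \<subseteq> labels d" for k by (intro PiE_mono) auto
  have removed: "(\<Sum>v\<in>?R k. m v) \<le> mass_ratio s ^ d * ?K" for k
  proof -
    have "(\<Sum>v\<in>?R k. m v) = (\<Prod>i<d. \<Sum>c\<in>{0, ?\<sigma> k i}. piece_mass s c)"
      unfolding m_def by (rule prod_sum_PiE[symmetric]) auto
    \<comment> \<open>The maximum in \<open>mass_ratio\<close> covers both values of
      \<open>?\<sigma> k i\<close>, so the bound does not depend on the position of the
      point.\<close>
    also have "\<dots> \<le> (\<Prod>i<d. mass_ratio s / (s + 2))"
      using piece_mass_nonneg_0[OF s] piece_mass_pos_1[OF s] piece_mass_pos_2[OF s] s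
      by (intro prod_mono) (auto simp: mass_ratio_def)
    also have "\<dots> = mass_ratio s ^ d * ?K"
      by (simp add: power_divide)
    finally show ?thesis .
  qed
  have "?K = (\<Sum>v\<in>labels d. m v)" by (simp add: total)
  also have "\<dots> = (\<Sum>v\<in>S. m v) + (\<Sum>v\<in>(\<Union>k<N. ?R k). m v)"
  proof -
    have "(\<Union>k<N. ?R k) \<subseteq> labels d" using R_sub by blast
    from sum.subset_diff[OF this finite_labels, of m] show ?thesis by (simp add: S_def)
  qed
  also have "(\<Sum>v\<in>(\<Union>k<N. ?R k). m v) \<le> (\<Sum>k<N. \<Sum>v\<in>?R k. m v)"
  proof -
    have fin: "finite (?R k)" for k by (intro finite_PiE) auto
    have "(\<Sum>v\<in>(\<Union>k<N. ?R k). m v) = (\<Sum>v\<in>(\<Union>k<N. ?R k). \<bar>m v\<bar>)"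
      using R_sub m_nonneg by (intro sum.cong) (auto simp: subset_eq)
    also have "\<dots> \<le> (\<Sum>k<N. \<Sum>v\<in>?R k. \<bar>m v\<bar>)"
      by (rule sum_UN_le) (use fin in auto)
    also have "\<dots> = (\<Sum>k<N. \<Sum>v\<in>?R k. m v)"
      using R_sub m_nonneg by (intro sum.cong) (auto simp: subset_eq)
    finally show ?thesis .
  qed
  also have "\<dots> \<le> (\<Sum>k<N. mass_ratio s ^ d * ?K)" by (intro sum_mono removed)
  finally have "?\<theta> * ?K \<le> (\<Sum>v\<in>S. m v)" by (simp add: algebra_simps)
  hence dual: "?\<theta> * ?K \<le> \<bar>\<integral>t. ?D t * F t \<partial>unit_cube d\<bar>"
    by (simp add: pairing)

  have "?\<theta> powr (s + 1) * ?K \<le> (\<integral>t. \<bar>?D t\<bar> powr (s + 1) \<partial>unit_cube d)"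
  proof (rule powr_integral_ge_dual[where q = "real n" and g = F])
    show "s + 1 > 1" "real n > 1" using s \<open>real n > 1\<close> by auto
    have "real n = (s + 1) / s" using n s by (simp add: eq_divide_eq mult.commute)
    moreover have "1 / (s + 1) + 1 / ((s + 1) / s) = 1" using s by (simp add: divide_simps)
    ultimately show "1 / (s + 1) + 1 / real n = 1" by (simp only:)
    show "integrable (unit_cube d) (\<lambda>t. \<bar>?D t\<bar> powr (s + 1))"
      by (rule integrable_unit_cube_bounded[where B = "A powr (s + 1)"])
         (use s D_bound in \<open>auto intro!: powr_mono2\<close>)
    show "integrable (unit_cube d) (\<lambda>t. \<bar>F t\<bar> powr real n)"
      by (rule integrable_unit_cube_bounded[where B = "B powr real n"])
         (use s F_bound in \<open>auto intro!: powr_mono2 simp: B_def\<close>)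
    show "integrable (unit_cube d) (\<lambda>t. ?D t * F t)"
      by (rule integrable_unit_cube_bounded[where B = "A * B"])
         (use D_bound F_bound A in \<open>auto intro!: mult_mono simp: abs_mult B_def\<close>)
  qed (use F_norm dual \<theta> in auto)
  hence "(?\<theta> powr (s + 1) * ?K) powr (1 / (s + 1)) \<le> gen_Lp_disc (s + 1) d N x a"
    unfolding gen_Lp_disc_def using s by (intro powr_mono2) auto
  \<comment> \<open>The power of \<open>s + 2\<close> on the right is the initial discrepancy for
    \<open>p = s + 1\<close>.\<close>
  also have "(?\<theta> powr (s + 1) * ?K) powr (1 / (s + 1)) = ?\<theta> * (s + 2) powr (- real d / (s + 1))"
  proof -
    have "?K = (s + 2) powr (- real d)"
      using s by (simp add: powr_minus powr_realpow power_one_over inverse_eq_divide)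
    moreover have "(?\<theta> powr (s + 1)) powr (1 / (s + 1)) = ?\<theta>"
      using s \<theta> by (simp add: powr_powr powr_one)
    ultimately show ?thesis using s by (simp add: powr_mult powr_powr)
  qed
  finally show ?thesis .
qed

lemma gen_disc_ge:
  fixes s :: real and n :: nat
  assumes "s > 0" "even n" "s * n = s + 1" "N > 0" "1 - real N * mass_ratio s ^ d \<ge> 0"
  shows "gen_disc (s + 1) N d \<ge> (1 - real N * mass_ratio s ^ d) * (s + 2) powr (- real d / (s + 1))"
proof -
  have "(\<lambda>_ _. 0) \<in> point_sets d N" by (simp add: point_sets_def)
  hence "{gen_Lp_disc (s + 1) d N x a | x a. x \<in> point_sets d N} \<noteq> {}" by blast
  hence "Inf {gen_Lp_disc (s + 1) d N x a | x a. x \<in> point_sets d N}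
      \<ge> (1 - real N * mass_ratio s ^ d) * (s + 2) powr (- real d / (s + 1))"
    by (rule cInf_greatest) (use gen_Lp_disc_ge[OF assms(1-3) _ assms(5)] in blast)
  thus ?thesis using assms(4) by (simp add: gen_disc_def)
qed

section \<open>Regular grids attain arbitrarily small discrepancy\<close>

lemma grid_average_bounds:
  fixes t :: real
  assumes "m > 0" "0 \<le> t" "t \<le> 1"
  defines "u \<equiv> (\<Sum>j<m. (if real j / m < t then 1 / real m else 0))"
  shows "0 \<le> u" "u \<le> 1" "\<bar>u - t\<bar> \<le> 1 / m"
proof -
  let ?c = "\<lceil>m * t\<rceil>"
  have mt: "0 \<le> m * t" "m * t \<le> m" using assms by (auto simp: mult_left_le)
  hence c: "0 \<le> ?c" "?c \<le> m" by (auto simp: ceiling_le_iff)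
  \<comment> \<open>The grid points strictly below \<open>t\<close> number exactly the ceiling of
    \<open>m * t\<close>, so \<open>u\<close> is \<open>t\<close> rounded up to the grid.\<close>
  have "j < m \<and> real j / m < t \<longleftrightarrow> j < nat ?c" for j
  proof -
    have "j < nat ?c \<longleftrightarrow> real j < m * t" by (simp add: zless_nat_eq_int_zless less_ceiling_iff)
    moreover have "real j / m < t \<longleftrightarrow> real j < m * t" using assms(1) by (simp add: field_simps)
    ultimately show ?thesis using mt by auto
  qed
  hence "{j. j < m \<and> real j / m < t} = {..<nat ?c}" by auto
  hence "u = real (nat ?c) / m"
    by (simp add: u_def sum.If_cases Int_def conj_commute)
  hence u: "u = of_int ?c / m" using c by simp
  show "0 \<le> u" "u \<le> 1" using u c assms(1) by (auto simp: divide_le_eq)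
  have "m * t \<le> of_int ?c" "of_int ?c < m * t + 1" by linarith+
  thus "\<bar>u - t\<bar> \<le> 1 / m"
    using assms(1) mult_left_mono[of "of_int ?c" "m * t + 1" m] by (simp add: u abs_le_iff field_simps)
qed

text \<open>For the full grid with equal weights \<open>(1 / m) ^ d\<close>, the weighted count
  factors over the coordinates. The difference of the two products is at most the sum of the
  coordinate errors, each at most \<open>1 / m\<close>.\<close>

lemma ex_point_set_gen_disc_fun_le:
  assumes "m > 0"
  obtains x a where "x \<in> point_sets d (m ^ d)"
    "\<And>t. t \<in> space (unit_cube d) \<Longrightarrow> \<bar>gen_disc_fun d (m ^ d) x a t\<bar> \<le> d / m"
proof -
  let ?G = "PiE {..<d} (\<lambda>_. {..<m})"
  have "finite ?G" "card ?G = m ^ d" by (auto intro: finite_PiE simp: card_PiE)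
  then obtain e where e: "bij_betw e {..<m ^ d} ?G"
    using ex_bij_betw_nat_finite[of ?G] by (auto simp: atLeast0LessThan)
  define x where "x = (\<lambda>k i. real (e k i) / m)"
  have "e k i < m" if "k < m ^ d" "i < d" for k i
    using bij_betwE[OF e] that by (auto simp: PiE_iff)
  hence x: "x \<in> point_sets d (m ^ d)"
    using assms by (auto simp: point_sets_def x_def)
  have "\<bar>gen_disc_fun d (m ^ d) x (\<lambda>_. (1 / real m) ^ d) t\<bar> \<le> d / m"
    if t: "t \<in> space (unit_cube d)" for t
  proof -
    have t01: "0 \<le> t i" "t i \<le> 1" if "i < d" for i
      using t that by (auto simp: space_unit_cube PiE_iff)
    let ?u = "\<lambda>i. \<Sum>j<m. (if real j / m < t i then 1 / real m else 0)"
    have "(\<Sum>k<m ^ d. (1 / real m) ^ d * (if \<forall>i<d. 0 \<le> x k i \<and> x k i < t i then 1 else 0))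
        = (\<Sum>k<m ^ d. \<Prod>i<d. (if real (e k i) / m < t i then 1 / real m else 0))"
    proof (intro sum.cong refl)
      fix k
      have "(1 / real m) ^ d * (if \<forall>i<d. 0 \<le> x k i \<and> x k i < t i then 1 else 0)
          = (\<Prod>i<d. 1 / real m * (if 0 \<le> x k i \<and> x k i < t i then 1 else 0))"
        unfolding if_ball_eq_prod prod.distrib by simp
      also have "\<dots> = (\<Prod>i<d. (if real (e k i) / m < t i then 1 / real m else 0))"
        by (intro prod.cong) (auto simp: x_def)
      finally show "(1 / real m) ^ d * (if \<forall>i<d. 0 \<le> x k i \<and> x k i < t i then 1 else 0)
          = (\<Prod>i<d. (if real (e k i) / m < t i then 1 / real m else 0))" .
    qed
    also have "\<dots> = (\<Sum>v\<in>?G. \<Prod>i<d. (if real (v i) / m < t i then 1 / real m else 0))"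
      by (rule sum.reindex_bij_betw[OF e])
    also have "\<dots> = (\<Prod>i<d. ?u i)"
      by (rule prod_sum_PiE[symmetric]) auto
    finally have "gen_disc_fun d (m ^ d) x (\<lambda>_. (1 / real m) ^ d) t = (\<Prod>i<d. ?u i) - (\<Prod>i<d. t i)"
      by (simp add: gen_disc_fun_def)
    also have "\<bar>\<dots>\<bar> \<le> (\<Sum>i<d. \<bar>?u i - t i\<bar>)"
      using norm_prod_diff[of "{..<d}" ?u t] grid_average_bounds[OF assms t01] t01 by simp
    also have "\<dots> \<le> (\<Sum>i<d. 1 / m)"
      using grid_average_bounds(3)[OF assms t01] by (intro sum_mono) auto
    finally show ?thesis by simp
  qed
  thus ?thesis using that x by blast
qed

text \<open>Without this, the \<open>LEAST\<close> in \<open>inv_gen_disc\<close> would be an unspecified number.\<close>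

lemma gen_disc_arbitrarily_small:
  assumes "p > 0" "\<delta> > 0"
  shows "\<exists>N. gen_disc p N d \<le> \<delta>"
proof -
  obtain m :: nat where m: "real m > d / \<delta>" using reals_Archimedean2 by blast
  have "d / \<delta> \<ge> 0" using assms by simp
  hence "m > 0" using m by simp
  obtain x a where x: "x \<in> point_sets d (m ^ d)"
    and xa: "\<And>t. t \<in> space (unit_cube d) \<Longrightarrow> \<bar>gen_disc_fun d (m ^ d) x a t\<bar> \<le> d / m"
    using ex_point_set_gen_disc_fun_le[OF \<open>m > 0\<close>, of d] by blast
  interpret prob_space "unit_cube d" by (rule prob_space_unit_cube)
  have le: "\<bar>gen_disc_fun d (m ^ d) x a t\<bar> powr p \<le> (d / m) powr p" if "t \<in> space (unit_cube d)" for t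
    using xa[OF that] assms by (intro powr_mono2) auto
  have "integrable (unit_cube d) (\<lambda>t. \<bar>gen_disc_fun d (m ^ d) x a t\<bar> powr p)"
    by (rule integrable_unit_cube_bounded[where B = "(d / m) powr p"]) (use le in auto)
  hence "(\<integral>t. \<bar>gen_disc_fun d (m ^ d) x a t\<bar> powr p \<partial>unit_cube d) \<le> (d / m) powr p"
    by (intro integral_le_const AE_I2 le)
  hence "gen_Lp_disc p d (m ^ d) x a \<le> ((d / m) powr p) powr (1 / p)"
    unfolding gen_Lp_disc_def using assms by (intro powr_mono2) auto
  also have "\<dots> = d / m" using assms by (simp add: powr_powr powr_one)
  also have "\<dots> \<le> \<delta>" using m \<open>m > 0\<close> assms by (simp add: field_simps)
  finally have "gen_Lp_disc p d (m ^ d) x a \<le> \<delta>" .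
  moreover have "gen_disc p (m ^ d) d \<le> gen_Lp_disc p d (m ^ d) x a"
  proof -
    have "bdd_below {gen_Lp_disc p d (m ^ d) x a | x a. x \<in> point_sets d (m ^ d)}"
      by (rule bdd_belowI[of _ 0]) (auto simp: gen_Lp_disc_def)
    thus ?thesis
      unfolding gen_disc_def using x \<open>m > 0\<close> by (auto intro!: cInf_lower)
  qed
  ultimately show ?thesis by (meson order.trans)
qed

section \<open>From the discrepancy bound to the inverse\<close>

lemma inv_gen_disc_ge:
  fixes s :: real and n :: nat
  assumes s: "s > 0" "even n" "s * n = s + 1" and \<epsilon>: "0 < \<epsilon>" "\<epsilon> < 1"
  shows "real (inv_gen_disc (s + 1) \<epsilon> d) \<ge> (1 - \<epsilon>) * (1 / mass_ratio s) ^ d"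
proof -
  define N where "N = inv_gen_disc (s + 1) \<epsilon> d"
  let ?K = "(s + 2) powr (- real d / (s + 1))"
  have K: "?K > 0" "gen_disc (s + 1) 0 d = ?K"
    using s by (auto simp: gen_disc_def add.assoc)
  have "\<exists>N. gen_disc (s + 1) N d \<le> \<epsilon> * gen_disc (s + 1) 0 d"
    using K s \<epsilon> by (intro gen_disc_arbitrarily_small) auto
  hence N: "gen_disc (s + 1) N d \<le> \<epsilon> * ?K"
    unfolding N_def inv_gen_disc_def K(2) by (rule LeastI_ex)
  \<comment> \<open>With no points the discrepancy is \<open>?K\<close> itself, which exceeds
    \<open>\<epsilon> * ?K\<close>.\<close>
  have "N > 0"
    using N K \<epsilon> by (cases "N = 0") auto
  have "1 - real N * mass_ratio s ^ d \<le> \<epsilon>"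
  proof (rule ccontr)
    assume *: "\<not> ?thesis"
    hence "1 - real N * mass_ratio s ^ d \<ge> 0" using \<epsilon> by simp
    from order.trans[OF gen_disc_ge[OF s \<open>N > 0\<close> this] N]
    have "(1 - real N * mass_ratio s ^ d) * ?K \<le> \<epsilon> * ?K" .
    with * K show False by simp
  qed
  thus ?thesis
    using mass_ratio_bounds[OF s(1)] by (simp add: N_def power_divide field_simps)
qed

theorem theorem3:
  fixes l :: nat
  assumes "l \<ge> 1"
  defines "p \<equiv> 2 * real l / (2 * real l - 1)"
  shows "\<exists>C > 1. \<forall>\<epsilon>. 0 < \<epsilon> \<and> \<epsilon> < 1 \<longrightarrow>
           (\<exists>r :: nat \<Rightarrow> real. r \<longlonglongrightarrow> 0 \<and>
              (\<forall>d \<ge> 1. real (inv_gen_disc p \<epsilon> d) \<ge> C ^ d * (1 + r d)))"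
proof -
  \<comment> \<open>This is \<open>p - 1\<close>, and \<open>2 * l\<close> is the exponent conjugate
    to \<open>p\<close>.\<close>
  define s where "s = 1 / (2 * real l - 1)"
  have s: "s > 0" "s * real (2 * l) = s + 1" and p: "p = s + 1"
    using assms(1) by (auto simp: s_def p_def field_simps)
  \<comment> \<open>The square root leaves a spare factor \<open>C ^ d\<close> in the bound of
    \<open>inv_gen_disc_ge\<close>, which eventually absorbs the constant
    \<open>1 - \<epsilon>\<close>; \<open>C\<close> itself is independent of
    \<open>\<epsilon>\<close>.\<close>
  define C where "C = sqrt (1 / mass_ratio s)"
  have C: "C > 1" "C * C = 1 / mass_ratio s"
    using mass_ratio_bounds[OF s(1)] by (auto simp: C_def)
  show ?thesis
  proof (intro exI[of _ C] conjI allI impI)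
    fix \<epsilon> :: real assume \<epsilon>: "0 < \<epsilon> \<and> \<epsilon> < 1"
    \<comment> \<open>The correction is negative only while
      \<open>(1 - \<epsilon>) * C ^ d < 1\<close>, that is, for finitely many
      \<open>d\<close>.\<close>
    define r where "r = (\<lambda>d. min 0 ((1 - \<epsilon>) * C ^ d - 1))"
    obtain d0 where d0: "1 / (1 - \<epsilon>) < C ^ d0" using real_arch_pow[OF C(1)] by blast
    have "r d = 0" if "d \<ge> d0" for d
    proof -
      have "C ^ d0 \<le> C ^ d" using C that by (intro power_increasing) auto
      with d0 have "1 / (1 - \<epsilon>) < C ^ d" by linarith
      thus ?thesis using \<epsilon> by (simp add: r_def field_simps)
    qed
    hence "r \<longlonglongrightarrow> 0"
      by (intro tendsto_eventually) (auto simp: eventually_sequentially)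
    moreover have "C ^ d * (1 + r d) \<le> real (inv_gen_disc p \<epsilon> d)" for d
    proof -
      have "C ^ d * (1 + r d) \<le> C ^ d * ((1 - \<epsilon>) * C ^ d)"
        using C by (intro mult_left_mono) (auto simp: r_def)
      also have "\<dots> = (1 - \<epsilon>) * (1 / mass_ratio s) ^ d"
        by (simp add: power_mult_distrib flip: C(2))
      also have "\<dots> \<le> real (inv_gen_disc p \<epsilon> d)"
        unfolding p using s \<epsilon> by (intro inv_gen_disc_ge[where n = "2 * l"]) auto
      finally show ?thesis .
    qed
    ultimately show "\<exists>r. r \<longlonglongrightarrow> 0 \<and> (\<forall>d\<ge>1. C ^ d * (1 + r d) \<le> real (inv_gen_disc p \<epsilon> d))"
      by blast
  qed (rule C(1))
qed

end
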